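(* Let $\lambda=\langle0^{m_0},1^{m_1},\dots,s^{m_s}\rangle$ be a partition with $n=\sum_{r=0}^s m_r$ parts and $m_0\ge1$, and let $x_1,\dots,x_n>0$. The distribution $\hat\pi$ on the set $\widehat\Omega_\lambda$ of multiline diagrams with content $\lambda$ defined by $$\hat\pi(\hat\eta)=\frac{\mathrm{wt}(\hat\eta)}{Z_\lambda}=\frac1{Z_\lambda}\prod_{i=1}^n x_i^{v_i(\hat\eta)},\qquad Z_\lambda=\sum_{\hat\eta'\in\widehat\Omega_\lambda}\mathrm{wt}(\hat\eta'),$$ is stationary for the multiline process with content $\lambda$.
   Context: $\langle 0^{m_0},\dots,s^{m_s}\rangle$ denotes the partition of length $n$ with exactly $m_r$ parts equal to $r$; $M_r=m_r+\cdots+m_s$ for $1\le r\le s$. **Multiline diagrams.** $\widehat\Omega_\lambda$ is the set of configurations on the array with rows $1,\dots,s$ (numbered from bottom to top) and columns $1,\dots,n$ (from left to right, arranged cyclically, column $n$ being followed by column $1$), in which each site $(r,i)$ holds either one particle or a vacancy, and row $r$ contains exactly $M_r$ particles. $v_i(\hat\eta)$ is the number of particles in column $i$ of $\hat\eta$, and $\mathrm{wt}(\hat\eta)=\prod_{i=1}^n x_i^{v_i(\hat\eta)}$. **Multiline process (multiline PushTASEP).** This is the continuous-time Markov chain on $\widehat\Omega_\lambda$ in which, independently for each column $i$, a bell rings at rate $1/x_i$ at the bottom-row site $(1,i_1)$ with $i_1=i$. It triggers bells at sites $(2,i_2),\dots,(s,i_s)$ as follows. When the bell on row $r$ rings at $(r,i_r)$: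 (a) if $(r,i_r)$ is empty, row $r$ is unchanged and $i_{r+1}=i_r$; (b) if $(r,i_r)$ contains a particle, that particle jumps to the first empty site of row $r$ to its right (cyclically), and $i_{r+1}$ is the column it jumps to. The moves on all rows occur simultaneously. *)

theory Defs
  imports Complex_Main
begin

section \<open>Continuous-time Markov chains on a finite state space\<close>

text \<open>A chain on the finite set \<open>S\<close> is given by its jump rates: \<open>q \<eta> \<zeta>\<close> is the rate of the
  transition from \<open>\<eta>\<close> to \<open>\<zeta>\<close>. Diagonal values of \<open>q\<close> (rings that change nothing) have no effect.\<close>

definition generator :: "'a set \<Rightarrow> ('a \<Rightarrow> 'a \<Rightarrow> real) \<Rightarrow> 'a \<Rightarrow> 'a \<Rightarrow> real" where
  "generator S q \<eta> \<zeta> = (if \<eta> = \<zeta> then - (\<Sum>\<xi>\<in>S - {\<eta>}. q \<eta> \<xi>) else q \<eta> \<zeta>)"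

primrec matrix_power :: "'a set \<Rightarrow> ('a \<Rightarrow> 'a \<Rightarrow> real) \<Rightarrow> nat \<Rightarrow> 'a \<Rightarrow> 'a \<Rightarrow> real" where
  "matrix_power S A 0 \<eta> \<zeta> = (if \<eta> = \<zeta> then 1 else 0)"
| "matrix_power S A (Suc k) \<eta> \<zeta> = (\<Sum>\<xi>\<in>S. matrix_power S A k \<eta> \<xi> * A \<xi> \<zeta>)"

text \<open>The probability of being in \<open>\<zeta>\<close> at time \<open>t\<close> when started in \<open>\<eta>\<close>: the entry of the matrix
  exponential of \<open>t\<close> times the generator. For finite \<open>S\<close> the series converges absolutely.\<close>

definition transition_prob ::
    "'a set \<Rightarrow> ('a \<Rightarrow> 'a \<Rightarrow> real) \<Rightarrow> real \<Rightarrow> 'a \<Rightarrow> 'a \<Rightarrow> real" where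
  "transition_prob S q t \<eta> \<zeta> =
     (\<Sum>k. t ^ k / fact k * matrix_power S (generator S q) k \<eta> \<zeta>)"

definition prob_distribution :: "'a set \<Rightarrow> ('a \<Rightarrow> real) \<Rightarrow> bool" where
  "prob_distribution S p \<longleftrightarrow> (\<forall>\<eta>\<in>S. 0 \<le> p \<eta>) \<and> (\<Sum>\<eta>\<in>S. p \<eta>) = 1"

definition stationary_distribution ::
    "'a set \<Rightarrow> ('a \<Rightarrow> 'a \<Rightarrow> real) \<Rightarrow> ('a \<Rightarrow> real) \<Rightarrow> bool" where
  "stationary_distribution S q p \<longleftrightarrow> prob_distribution S p \<and>
     (\<forall>t\<ge>0. \<forall>\<zeta>\<in>S. (\<Sum>\<eta>\<in>S. p \<eta> * transition_prob S q t \<eta> \<zeta>) = p \<zeta>)"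

section \<open>Multiline diagrams\<close>

text \<open>A configuration is its set of occupied sites \<open>(r, i)\<close> (row, column). The content
  \<open>\<langle>0\<^bsup>m 0\<^esup>, \<dots>, s\<^bsup>m s\<^esup>\<rangle>\<close> is given by \<open>s\<close> and the multiplicity function \<open>m\<close>, of
  which only the values at \<open>0, \<dots>, s\<close> matter.\<close>

type_synonym config = "(nat \<times> nat) set"

definition row_count :: "nat \<Rightarrow> (nat \<Rightarrow> nat) \<Rightarrow> nat \<Rightarrow> nat" where
  "row_count s m r = (\<Sum>t=r..s. m t)"

definition multiline_diagrams :: "nat \<Rightarrow> nat \<Rightarrow> (nat \<Rightarrow> nat) \<Rightarrow> config set" where
  "multiline_diagrams n s m =
     {\<eta>. \<eta> \<subseteq> {1..s} \<times> {1..n} \<and> (\<forall>r\<in>{1..s}. card {i. (r, i) \<in> \<eta>} = row_count s m r)}"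

definition column_count :: "config \<Rightarrow> nat \<Rightarrow> nat" where
  "column_count \<eta> i = card {r. (r, i) \<in> \<eta>}"

definition weight :: "nat \<Rightarrow> (nat \<Rightarrow> real) \<Rightarrow> config \<Rightarrow> real" where
  "weight n x \<eta> = (\<Prod>i=1..n. x i ^ column_count \<eta> i)"

definition partition_function :: "nat \<Rightarrow> nat \<Rightarrow> (nat \<Rightarrow> nat) \<Rightarrow> (nat \<Rightarrow> real) \<Rightarrow> real" where
  "partition_function n s m x = (\<Sum>\<eta>\<in>multiline_diagrams n s m. weight n x \<eta>)"

definition multiline_distribution ::
    "nat \<Rightarrow> nat \<Rightarrow> (nat \<Rightarrow> nat) \<Rightarrow> (nat \<Rightarrow> real) \<Rightarrow> config \<Rightarrow> real" where
  "multiline_distribution n s m x \<eta> = weight n x \<eta> / partition_function n s m x"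

section \<open>The multiline process\<close>

definition next_column :: "nat \<Rightarrow> nat \<Rightarrow> nat" where
  "next_column n i = (if i = n then 1 else i + 1)"

text \<open>Meaningful only if row \<open>r\<close> has a vacancy; rows of multiline diagrams do when \<open>m 0 \<ge> 1\<close>.\<close>

definition first_empty :: "nat \<Rightarrow> config \<Rightarrow> nat \<Rightarrow> nat \<Rightarrow> nat" where
  "first_empty n \<eta> r i =
     (next_column n ^^ (LEAST d. 0 < d \<and> (r, (next_column n ^^ d) i) \<notin> \<eta>)) i"

text \<open>\<open>bell_out n \<eta> i r\<close> is the column in which row \<open>r + 1\<close> is rung after a ring at \<open>(1, i)\<close>, so
  the bell of row \<open>r \<ge> 1\<close> rings in column \<open>bell_out n \<eta> i (r - 1)\<close>. If a particle is there,
  it jumps to column \<open>bell_out n \<eta> i r\<close>.\<close>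

primrec bell_out :: "nat \<Rightarrow> config \<Rightarrow> nat \<Rightarrow> nat \<Rightarrow> nat" where
  "bell_out n \<eta> i 0 = i"
| "bell_out n \<eta> i (Suc r) =
     (let c = bell_out n \<eta> i r in if (Suc r, c) \<in> \<eta> then first_empty n \<eta> (Suc r) c else c)"

definition bell_column :: "nat \<Rightarrow> config \<Rightarrow> nat \<Rightarrow> nat \<Rightarrow> nat" where
  "bell_column n \<eta> i r = bell_out n \<eta> i (r - 1)"

definition jumping_rows :: "nat \<Rightarrow> nat \<Rightarrow> config \<Rightarrow> nat \<Rightarrow> nat set" where
  "jumping_rows n s \<eta> i = {r \<in> {1..s}. (r, bell_column n \<eta> i r) \<in> \<eta>}"

definition ring_bell :: "nat \<Rightarrow> nat \<Rightarrow> nat \<Rightarrow> config \<Rightarrow> config" where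
  "ring_bell n s i \<eta> =
     (\<eta> - (\<lambda>r. (r, bell_column n \<eta> i r)) ` jumping_rows n s \<eta> i)
       \<union> (\<lambda>r. (r, bell_out n \<eta> i r)) ` jumping_rows n s \<eta> i"

definition multiline_rate ::
    "nat \<Rightarrow> nat \<Rightarrow> (nat \<Rightarrow> real) \<Rightarrow> config \<Rightarrow> config \<Rightarrow> real" where
  "multiline_rate n s x \<eta> \<zeta> = (\<Sum>i\<in>{i \<in> {1..n}. ring_bell n s i \<eta> = \<zeta>}. 1 / x i)"

end

theory Submission
  imports Defs
begin

text \<open>Send a diagram \<open>\<eta>\<close> and a column \<open>i\<close> to the diagram obtained by ringing column \<open>i\<close> together
  with the column \<open>j\<close> in which the bell leaves the top row. On each row the move can be undone:
  the outgoing column is occupied afterwards iff a particle jumped, and the jump then started at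
  the first vacancy to its left. So this map is a bijection. A particle jumping from column \<open>a\<close> to
  \<open>b\<close> changes the weight by \<open>x b / x a\<close>; these factors telescope along the rows, so ringing column
  \<open>i\<close> in \<open>\<eta>\<close> carries the probability flow \<open>wt \<eta> / x i = wt \<zeta> / x j\<close> into the new diagram \<open>\<zeta>\<close>.
  Summing over \<open>j\<close>, the flow into \<open>\<zeta>\<close> equals the flow out of it.\<close>

section \<open>Stationarity from balance\<close>

text \<open>The sum of all absolute entries dominates every absolute column sum, so each further
  factor \<open>A\<close> costs at most one more factor of it. This crude bound serves only to make
  the exponential series converge.\<close>

lemma matrix_power_bound:
  assumes "finite S" "\<eta> \<in> S" "\<zeta> \<in> S"
  shows "\<bar>matrix_power S A k \<eta> \<zeta>\<bar> \<le> (\<Sum>\<xi>\<in>S. \<Sum>\<zeta>\<in>S. \<bar>A \<xi> \<zeta>\<bar>) ^ k"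
  using assms(3)
proof (induction k arbitrary: \<zeta>)
  case 0
  then show ?case by simp
next
  case (Suc k)
  let ?C = "\<Sum>\<xi>\<in>S. \<Sum>\<zeta>\<in>S. \<bar>A \<xi> \<zeta>\<bar>"
  have C0: "0 \<le> ?C" by (intro sum_nonneg) auto
  have "\<bar>matrix_power S A (Suc k) \<eta> \<zeta>\<bar> \<le> (\<Sum>\<xi>\<in>S. \<bar>matrix_power S A k \<eta> \<xi> * A \<xi> \<zeta>\<bar>)"
    by simp
  also have "\<dots> \<le> (\<Sum>\<xi>\<in>S. ?C ^ k * \<bar>A \<xi> \<zeta>\<bar>)"
    by (intro sum_mono) (simp add: abs_mult mult_right_mono Suc.IH)
  also have "\<dots> = ?C ^ k * (\<Sum>\<xi>\<in>S. \<bar>A \<xi> \<zeta>\<bar>)"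
    by (simp add: sum_distrib_left)
  also have "\<dots> \<le> ?C ^ k * ?C"
    using C0 Suc.prems assms(1)
    by (intro mult_left_mono sum_mono member_le_sum) auto
  finally show ?case by (simp add: mult.commute)
qed

lemma summable_matrix_exponential:
  assumes "finite S" "\<eta> \<in> S" "\<zeta> \<in> S"
  shows "summable (\<lambda>k. t ^ k / fact k * matrix_power S A k \<eta> \<zeta>)"
proof (rule summable_comparison_test')
  let ?C = "\<Sum>\<xi>\<in>S. \<Sum>\<zeta>\<in>S. \<bar>A \<xi> \<zeta>\<bar>"
  show "summable (\<lambda>k. (\<bar>t\<bar> * ?C) ^ k / fact k)"
    using summable_exp[of "\<bar>t\<bar> * ?C"] by (simp add: field_simps)
  show "norm (t ^ k / fact k * matrix_power S A k \<eta> \<zeta>) \<le> (\<bar>t\<bar> * ?C) ^ k / fact k" for k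
    using mult_left_mono[OF matrix_power_bound[OF assms, of A k], of "\<bar>t\<bar> ^ k / fact k"]
    by (simp add: abs_mult power_abs power_mult_distrib)
qed

text \<open>A left null vector of \<open>A\<close> is killed by every positive power of
  \<open>A\<close>. At \<open>k = 0\<close> the power is the identity matrix and leaves
  \<open>p\<close> unchanged.\<close>

lemma sum_matrix_power_null_vector:
  assumes "finite S" "\<And>\<zeta>. \<zeta> \<in> S \<Longrightarrow> (\<Sum>\<eta>\<in>S. p \<eta> * A \<eta> \<zeta>) = 0" "\<zeta> \<in> S"
  shows "(\<Sum>\<eta>\<in>S. p \<eta> * matrix_power S A k \<eta> \<zeta>) = (if k = 0 then p \<zeta> else 0)"
  using assms(3)
proof (induction k arbitrary: \<zeta>)
  case 0
  then show ?case using assms(1) by (simp add: if_distrib sum.delta cong: if_cong)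
next
  case (Suc k)
  have "(\<Sum>\<eta>\<in>S. p \<eta> * matrix_power S A (Suc k) \<eta> \<zeta>)
      = (\<Sum>\<eta>\<in>S. \<Sum>\<xi>\<in>S. p \<eta> * matrix_power S A k \<eta> \<xi> * A \<xi> \<zeta>)"
    by (simp add: sum_distrib_left mult.assoc)
  also have "\<dots> = (\<Sum>\<xi>\<in>S. (\<Sum>\<eta>\<in>S. p \<eta> * matrix_power S A k \<eta> \<xi>) * A \<xi> \<zeta>)"
    by (subst sum.swap) (simp add: sum_distrib_right)
  also have "\<dots> = (\<Sum>\<xi>\<in>S. (if k = 0 then p \<xi> else 0) * A \<xi> \<zeta>)"
    by (intro sum.cong) (simp_all add: Suc.IH)
  also have "\<dots> = 0"
    using assms(2)[OF Suc.prems] by (cases "k = 0") auto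
  finally show ?case by simp
qed

text \<open>The diagonal rate \<open>q \<zeta> \<zeta>\<close> occurs in both sums on the right and
  cancels. Hence balance may be checked with rates that still count rings changing nothing.\<close>

lemma sum_generator:
  assumes "finite S" "\<zeta> \<in> S"
  shows "(\<Sum>\<eta>\<in>S. p \<eta> * generator S q \<eta> \<zeta>) = (\<Sum>\<eta>\<in>S. p \<eta> * q \<eta> \<zeta>) - p \<zeta> * (\<Sum>\<xi>\<in>S. q \<zeta> \<xi>)"
proof -
  have "(\<Sum>\<eta>\<in>S - {\<zeta>}. p \<eta> * generator S q \<eta> \<zeta>) = (\<Sum>\<eta>\<in>S - {\<zeta>}. p \<eta> * q \<eta> \<zeta>)"
    by (intro sum.cong) (auto simp: generator_def)
  then show ?thesis
    using assms by (simp add: sum.remove[of S \<zeta>] generator_def algebra_simps)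
qed

text \<open>Balance makes \<open>p\<close> a left null vector of the generator, so only the constant
  term of the exponential series survives. Summability allows the finite sum and the series to be
  exchanged.\<close>

lemma stationary_distributionI:
  assumes "finite S" "prob_distribution S p"
    and balance: "\<And>\<zeta>. \<zeta> \<in> S \<Longrightarrow> (\<Sum>\<eta>\<in>S. p \<eta> * q \<eta> \<zeta>) = p \<zeta> * (\<Sum>\<xi>\<in>S. q \<zeta> \<xi>)"
  shows "stationary_distribution S q p"
  unfolding stationary_distribution_def
proof (intro conjI allI ballI impI)
  fix t :: real and \<zeta> assume \<zeta>: "\<zeta> \<in> S"
  let ?P = "matrix_power S (generator S q)"
  have null: "(\<Sum>\<eta>\<in>S. p \<eta> * generator S q \<eta> \<xi>) = 0" if "\<xi> \<in> S" for \<xi>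
    using sum_generator[OF assms(1) that, of p q] balance[OF that] by simp
  have term_eq: "(\<Sum>\<eta>\<in>S. p \<eta> * (t ^ k / fact k * ?P k \<eta> \<zeta>)) = (if k = 0 then p \<zeta> else 0)" for k
  proof -
    have "(\<Sum>\<eta>\<in>S. p \<eta> * (t ^ k / fact k * ?P k \<eta> \<zeta>))
        = t ^ k / fact k * (\<Sum>\<eta>\<in>S. p \<eta> * ?P k \<eta> \<zeta>)"
      by (simp add: sum_distrib_left mult_ac)
    then show ?thesis
      using sum_matrix_power_null_vector[OF assms(1) null \<zeta>, where k = k] by simp
  qed
  have "(\<Sum>\<eta>\<in>S. p \<eta> * transition_prob S q t \<eta> \<zeta>)
      = (\<Sum>\<eta>\<in>S. \<Sum>k. p \<eta> * (t ^ k / fact k * ?P k \<eta> \<zeta>))"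
    unfolding transition_prob_def
    by (intro sum.cong refl suminf_mult[symmetric] summable_matrix_exponential assms(1) \<zeta>)
  also have "\<dots> = (\<Sum>k. \<Sum>\<eta>\<in>S. p \<eta> * (t ^ k / fact k * ?P k \<eta> \<zeta>))"
    by (intro suminf_sum[symmetric] summable_mult summable_matrix_exponential assms(1) \<zeta>)
  also have "\<dots> = (\<Sum>k. if k = 0 then p \<zeta> else 0)"
    by (simp only: term_eq)
  also have "\<dots> = p \<zeta>"
    using suminf_finite[of "{0}" "\<lambda>k. if k = 0 then p \<zeta> else 0"] by simp
  finally show "(\<Sum>\<eta>\<in>S. p \<eta> * transition_prob S q t \<eta> \<zeta>) = p \<zeta>" .
qed (fact assms(2))

section \<open>The move on a single row\<close>

text \<open>With columns renumbered from 0, \<open>next_column\<close> is addition of 1 modulo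
  \<open>n\<close>.\<close>

lemma funpow_next_column:
  assumes "i \<in> {1..n}"
  shows "(next_column n ^^ k) i = (i - 1 + k) mod n + 1"
proof (induction k)
  case 0
  have "(i - 1) mod n = i - 1" using assms by (intro mod_less) auto
  then show ?case using assms by simp
next
  case (Suc k)
  have "(next_column n ^^ Suc k) i = next_column n ((i - 1 + k) mod n + 1)"
    using Suc.IH by simp
  also have "\<dots> = (i - 1 + Suc k) mod n + 1" by (simp add: next_column_def mod_Suc)
  finally show ?case .
qed

lemma funpow_next_column_in:
  assumes "i \<in> {1..n}"
  shows "(next_column n ^^ k) i \<in> {1..n}"
proof -
  have "(i - 1 + k) mod n < n" using assms by (intro mod_less_divisor) auto
  then show ?thesis by (simp add: funpow_next_column[OF assms])
qed

lemma funpow_next_column_inj: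
  assumes "i \<in> {1..n}" "j \<in> {1..n}" "(next_column n ^^ k) i = (next_column n ^^ k) j"
  shows "i = j"
  using assms(3)
proof (induction k)
  case 0
  then show ?case by simp
next
  case (Suc k)
  have inj: "a = b" if "a \<in> {1..n}" "b \<in> {1..n}" "next_column n a = next_column n b" for a b
    using that by (cases "a = n"; cases "b = n") (auto simp: next_column_def)
  have "(next_column n ^^ k) i = (next_column n ^^ k) j"
    by (rule inj[OF funpow_next_column_in[OF assms(1)] funpow_next_column_in[OF assms(2)]])
      (use Suc.prems in simp)
  then show ?case by (rule Suc.IH)
qed

section \<open>Jumps to the first vacancy of one row\<close>

definition row :: "config \<Rightarrow> nat \<Rightarrow> nat set" where
  "row \<eta> r = {c. (r, c) \<in> \<eta>}"

definition first_gap :: "nat \<Rightarrow> nat set \<Rightarrow> nat \<Rightarrow> nat" where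
  "first_gap n R a = (next_column n ^^ (LEAST d. 0 < d \<and> (next_column n ^^ d) a \<notin> R)) a"

lemma first_empty_eq: "first_empty n \<eta> r a = first_gap n (row \<eta> r) a"
  by (simp add: first_empty_def first_gap_def row_def)

text \<open>As \<open>R\<close> misses a column, the search for a vacancy ends. The last property
  says that the walk does not come back to \<open>a\<close>; so vacating \<open>a\<close> leaves the
  columns passed on the way occupied.\<close>

lemma first_gapE:
  assumes "R \<subset> {1..n}" "a \<in> R"
  obtains d where "first_gap n R a = (next_column n ^^ d) a" "0 < d" "first_gap n R a \<notin> R"
    "\<forall>e<d. (next_column n ^^ e) a \<in> R"
    "\<forall>e. 0 < e \<longrightarrow> e \<le> d \<longrightarrow> (next_column n ^^ e) a \<noteq> a"
proof -
  let ?P = "\<lambda>d. 0 < d \<and> (next_column n ^^ d) a \<notin> R"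
  define d where "d = (LEAST d. ?P d)"
  have a: "a \<in> {1..n}" using assms by auto
  obtain c where c: "c \<in> {1..n}" "c \<notin> R" using assms(1) by blast
  \<comment> \<open>The walk from \<open>a\<close> to \<open>c\<close> takes
    \<open>n + c - a\<close> steps: the extra \<open>n\<close> keeps the number positive and
    prevents truncated subtraction.\<close>
  have "a - 1 + (n + c - a) = c - 1 + n" using a c by auto
  then have "(next_column n ^^ (n + c - a)) a = (c - 1) mod n + 1"
    by (simp only: funpow_next_column[OF a] mod_add_self2)
  also have "\<dots> = c"
    using c by (subst mod_less) auto
  finally have "(next_column n ^^ (n + c - a)) a = c" .
  then have "?P (n + c - a)" using a c by auto
  then have d: "?P d" unfolding d_def by (rule LeastI)
  have below: "(next_column n ^^ e) a \<in> R" if "e < d" for e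
    using not_less_Least[OF that[unfolded d_def]] assms(2) by (cases "e = 0") auto
  have "(next_column n ^^ e) a \<noteq> a" if "0 < e" "e \<le> d" for e
  proof
    assume eq: "(next_column n ^^ e) a = a"
    \<comment> \<open>After a return to \<open>a\<close> at step \<open>e\<close>, the vacancy at
      step \<open>d\<close> would already be met at step \<open>d - e\<close>.\<close>
    have "(next_column n ^^ d) a = (next_column n ^^ (d - e + e)) a" using that by simp
    also have "\<dots> = (next_column n ^^ (d - e)) a" by (simp only: funpow_add comp_apply eq)
    finally show False using below[of "d - e"] d that by simp
  qed
  moreover have "first_gap n R a = (next_column n ^^ d) a"
    by (simp add: first_gap_def d_def)
  ultimately show ?thesis using d below by (intro that[of d]) auto
qed

definition row_out :: "nat \<Rightarrow> nat set \<Rightarrow> nat \<Rightarrow> nat" where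
  "row_out n R a = (if a \<in> R then first_gap n R a else a)"

definition row_ring :: "nat \<Rightarrow> nat set \<Rightarrow> nat \<Rightarrow> nat set" where
  "row_ring n R a = (if a \<in> R then insert (row_out n R a) (R - {a}) else R)"

lemma row_out_in:
  assumes "R \<subset> {1..n}" "a \<in> {1..n}"
  shows "row_out n R a \<in> {1..n}"
proof (cases "a \<in> R")
  case True
  then show ?thesis
    using first_gapE[OF assms(1) True] funpow_next_column_in[OF assms(2)]
    unfolding row_out_def by metis
qed (use assms in \<open>simp add: row_out_def\<close>)

lemma row_out_notin:
  assumes "R \<subset> {1..n}"
  shows "row_out n R a \<notin> R"
  using first_gapE[OF assms] unfolding row_out_def by metis

text \<open>The resulting row and the outgoing column thus reveal whether a particle jumped.\<close>

lemma row_out_in_row_ring_iff: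
  "row_out n R a \<in> row_ring n R a \<longleftrightarrow> a \<in> R"
  by (auto simp: row_ring_def row_out_def)

lemma row_ring_subset:
  assumes "R \<subset> {1..n}" "a \<in> {1..n}"
  shows "row_ring n R a \<subseteq> {1..n}"
  using assms row_out_in[OF assms] by (auto simp: row_ring_def simp del: atLeastAtMost_iff)

lemma card_row_ring:
  assumes "R \<subset> {1..n}"
  shows "card (row_ring n R a) = card R"
proof -
  have "finite R" using assms finite_subset by blast
  then show ?thesis
    using row_out_notin[OF assms, of a]
    by (auto simp: row_ring_def card_Suc_Diff1 simp del: card_Diff_insert)
qed

text \<open>This is the weight change \<open>x b / x a\<close> of one jump, multiplied out to avoid
  division. Without a jump the outgoing column is \<open>a\<close> and both sides agree.\<close>

lemma prod_row_ring:
  fixes x :: "nat \<Rightarrow> real"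
  assumes "R \<subset> {1..n}"
  shows "prod x (row_ring n R a) * x a = prod x R * x (row_out n R a)"
proof -
  have "finite R" using assms finite_subset by blast
  then show ?thesis
    using row_out_notin[OF assms, of a] prod.remove[of R a x]
    by (auto simp: row_ring_def row_out_def)
qed

text \<open>Walking left from the landing column, all columns of the new row are occupied until the
  start of the jump, which is vacant. So the start is determined by the new row and the landing
  column.\<close>

lemma row_ring_jump_inj:
  assumes R: "R \<subset> {1..n}" "a \<in> R" and R': "R' \<subset> {1..n}" "a' \<in> R'"
    and ring: "row_ring n R a = row_ring n R' a'" and out: "row_out n R a = row_out n R' a'"
  shows "a = a'"
proof -
  let ?T = "row_ring n R a"
  \<comment> \<open>The columns strictly between start and landing lie in \<open>R\<close> and
    differ from \<open>a\<close>, so they stay occupied; the landing column is filled and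
    \<open>a\<close> is emptied.\<close>
  have mem: "\<exists>d. row_out n R a = (next_column n ^^ d) a \<and>
      (\<forall>e. 0 < e \<longrightarrow> e \<le> d \<longrightarrow> (next_column n ^^ e) a \<in> row_ring n R a) \<and> a \<notin> row_ring n R a"
    if "R \<subset> {1..n}" "a \<in> R" for R a
  proof -
    from that obtain d where d: "first_gap n R a = (next_column n ^^ d) a" "0 < d"
      "first_gap n R a \<notin> R" "\<forall>e<d. (next_column n ^^ e) a \<in> R"
      "\<forall>e. 0 < e \<longrightarrow> e \<le> d \<longrightarrow> (next_column n ^^ e) a \<noteq> a"
      by (elim first_gapE)
    have "(next_column n ^^ e) a \<in> row_ring n R a" if "0 < e" "e \<le> d" for e
      using d(4,5) d(1) that \<open>a \<in> R\<close>
      by (cases "e = d") (auto simp: row_ring_def row_out_def)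
    moreover have "a \<notin> row_ring n R a"
      using that d(3) by (auto simp: row_ring_def row_out_def)
    ultimately show ?thesis using d(1) that by (auto simp: row_out_def)
  qed
  obtain d where d: "row_out n R a = (next_column n ^^ d) a"
    "\<And>e. 0 < e \<Longrightarrow> e \<le> d \<Longrightarrow> (next_column n ^^ e) a \<in> ?T" "a \<notin> ?T"
    using mem[OF R] by blast
  obtain d' where d': "row_out n R a = (next_column n ^^ d') a'"
    "\<And>e. 0 < e \<Longrightarrow> e \<le> d' \<Longrightarrow> (next_column n ^^ e) a' \<in> ?T" "a' \<notin> ?T"
    using mem[OF R'] ring out by metis
  \<comment> \<open>Cancelling \<open>k\<close> common steps puts \<open>b\<close> at step
    \<open>l - k\<close> of the walk from \<open>c\<close>. If that step were positive,
    \<open>b\<close> would be occupied in \<open>?T\<close>.\<close>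
  have *: "b = c" if "k \<le> l" "b \<in> {1..n}" "c \<in> {1..n}" "b \<notin> ?T"
    "(next_column n ^^ k) b = (next_column n ^^ l) c"
    "\<And>e. 0 < e \<Longrightarrow> e \<le> l \<Longrightarrow> (next_column n ^^ e) c \<in> ?T" for k l b c
  proof -
    have "(next_column n ^^ l) c = (next_column n ^^ (k + (l - k))) c"
      using that(1) by simp
    also have "\<dots> = (next_column n ^^ k) ((next_column n ^^ (l - k)) c)"
      by (simp only: funpow_add comp_apply)
    finally have "b = (next_column n ^^ (l - k)) c"
      using that(2,3,5) funpow_next_column_in[OF that(3)] by (metis funpow_next_column_inj)
    with that(1,4) that(6)[of "l - k"] show ?thesis by (cases "l = k") auto
  qed
  have a: "a \<in> {1..n}" and a': "a' \<in> {1..n}" using R R' by auto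
  show ?thesis
  proof (cases "d \<le> d'")
    case True
    from *[OF this a a' d(3)] d(1) d' show ?thesis by metis
  next
    case False
    then have "d' \<le> d" by simp
    from *[OF this a' a d'(3)] d d'(1) show ?thesis by metis
  qed
qed

text \<open>Both preimages jump or neither does. After a jump the starts agree and moving the
  particle back restores the row; without a jump row and column are unchanged.\<close>

lemma row_ring_inj:
  assumes R: "R \<subset> {1..n}" and R': "R' \<subset> {1..n}"
    and ring: "row_ring n R a = row_ring n R' a'" and out: "row_out n R a = row_out n R' a'"
  shows "R = R' \<and> a = a'"
proof (cases "a \<in> R")
  case True
  then have a': "a' \<in> R'"
    using row_out_in_row_ring_iff ring out by metis
  have "a = a'" using row_ring_jump_inj[OF R True R' a' ring out] .
  have undo: "R = insert a (row_ring n R a - {row_out n R a})" if "R \<subset> {1..n}" "a \<in> R" for R a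
    using row_out_notin[OF that(1), of a] that(2) by (auto simp: row_ring_def)
  show ?thesis
    using undo[OF R True] undo[OF R' a'] \<open>a = a'\<close> ring out by metis
next
  case False
  then have "a' \<notin> R'"
    using row_out_in_row_ring_iff ring out by metis
  then show ?thesis using False ring out by (simp add: row_ring_def row_out_def)
qed

section \<open>The move on a diagram\<close>

lemma bell_out_Suc: "bell_out n \<eta> i (Suc r) = row_out n (row \<eta> (Suc r)) (bell_out n \<eta> i r)"
  by (simp add: Let_def row_out_def row_def first_empty_eq)

text \<open>The index \<open>r\<close> moves only a site of row \<open>r\<close>, and all bell
  columns are read off the old diagram. So the simultaneous move splits into one
  \<open>row_ring\<close> per row.\<close>

lemma row_ring_bell:
  assumes "Suc r \<le> s"
  shows "row (ring_bell n s i \<eta>) (Suc r) = row_ring n (row \<eta> (Suc r)) (bell_out n \<eta> i r)"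
proof -
  have image: "(k, c) \<in> (\<lambda>r. (r, f r)) ` J \<longleftrightarrow> k \<in> J \<and> c = f k"
    for k c J and f :: "nat \<Rightarrow> nat"
    by auto
  have "Suc r \<in> jumping_rows n s \<eta> i \<longleftrightarrow> bell_out n \<eta> i r \<in> row \<eta> (Suc r)"
    using assms by (simp add: jumping_rows_def bell_column_def row_def)
  then have "c \<in> row (ring_bell n s i \<eta>) (Suc r) \<longleftrightarrow>
      c \<in> row \<eta> (Suc r) \<and> \<not> (bell_out n \<eta> i r \<in> row \<eta> (Suc r) \<and> c = bell_out n \<eta> i r)
      \<or> bell_out n \<eta> i r \<in> row \<eta> (Suc r) \<and> c = bell_out n \<eta> i (Suc r)" for c
    unfolding row_def ring_bell_def mem_Collect_eq Un_iff Diff_iff image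
    by (simp add: bell_column_def del: bell_out.simps)
  then show ?thesis
    by (simp add: set_eq_iff bell_out_Suc row_ring_def del: bell_out.simps(2)) blast
qed

lemma ring_bell_rows:
  assumes "\<eta> \<subseteq> {1..s} \<times> UNIV"
  shows "ring_bell n s i \<eta> \<subseteq> {1..s} \<times> UNIV"
  using assms by (auto simp: ring_bell_def jumping_rows_def)

lemma config_eqI:
  assumes "\<eta> \<subseteq> {1..s} \<times> UNIV" "\<zeta> \<subseteq> {1..s} \<times> UNIV"
    and "\<And>r. r < s \<Longrightarrow> row \<eta> (Suc r) = row \<zeta> (Suc r)"
  shows "\<eta> = \<zeta>"
proof -
  have "(r, c) \<in> \<eta> \<longleftrightarrow> (r, c) \<in> \<zeta>" for r c
  proof (cases "r \<in> {1..s}")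
    case True
    then have "row \<eta> r = row \<zeta> r" using assms(3)[of "r - 1"] by auto
    then show ?thesis by (auto simp: row_def)
  next
    case False
    then show ?thesis using assms by blast
  qed
  then show ?thesis by auto
qed

text \<open>Particles are counted by rows instead of columns, by exchanging the two products. This
  is the form in which the weight changes telescope.\<close>

lemma weight_eq_prod_rows:
  assumes "\<eta> \<subseteq> {1..s} \<times> {1..n}"
  shows "weight n x \<eta> = (\<Prod>r<s. prod x (row \<eta> (Suc r)))"
proof -
  have fin: "finite \<eta>" using assms finite_subset by blast
  have "weight n x \<eta> = (\<Prod>i=1..n. \<Prod>r\<in>{r. (r, i) \<in> \<eta>}. x i)"
    by (simp add: weight_def column_count_def)
  also have "\<dots> = (\<Prod>i=1..n. \<Prod>r\<in>{r\<in>{1..s}. (r, i) \<in> \<eta>}. x i)"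
    using assms by (intro prod.cong refl) auto
  also have "\<dots> = (\<Prod>r=1..s. \<Prod>i\<in>{i\<in>{1..n}. (r, i) \<in> \<eta>}. x i)"
    by (rule prod.swap_restrict) auto
  also have "\<dots> = (\<Prod>r=1..s. prod x (row \<eta> r))"
    using assms by (intro prod.cong refl) (auto simp: row_def)
  also have "\<dots> = (\<Prod>r<s. prod x (row \<eta> (Suc r)))"
    unfolding image_Suc_lessThan[symmetric] by (simp add: prod.reindex)
  finally show ?thesis .
qed

lemma multiline_diagrams_iff:
  "\<eta> \<in> multiline_diagrams n s m \<longleftrightarrow> \<eta> \<subseteq> {1..s} \<times> UNIV \<and>
     (\<forall>r<s. row \<eta> (Suc r) \<subseteq> {1..n} \<and> card (row \<eta> (Suc r)) = row_count s m (Suc r))"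
proof -
  have ball: "(\<forall>r\<in>{1..s}. P r) \<longleftrightarrow> (\<forall>r<s. P (Suc r))" for P
    by (simp only: image_Suc_lessThan[symmetric] ball_simps) auto
  have "\<eta> \<subseteq> {1..s} \<times> {1..n} \<longleftrightarrow>
      \<eta> \<subseteq> {1..s} \<times> UNIV \<and> (\<forall>r\<in>{1..s}. row \<eta> r \<subseteq> {1..n})"
    by (fastforce simp: row_def)
  then show ?thesis
    unfolding multiline_diagrams_def ball row_def[symmetric] by blast
qed

lemma finite_multiline_diagrams: "finite (multiline_diagrams n s m)"
  by (rule finite_subset[of _ "Pow ({1..s} \<times> {1..n})"]) (auto simp: multiline_diagrams_def)

section \<open>Diagrams whose rows all have a vacancy\<close>

context
  fixes n s :: nat and m :: "nat \<Rightarrow> nat"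
  assumes n_eq: "n = (\<Sum>r=0..s. m r)" and m0: "m 0 \<ge> 1"
begin

text \<open>Parts equal to 0 contribute to no row, so \<open>m 0 \<ge> 1\<close> leaves a vacancy in
  every row.\<close>

lemma row_count_less: "row_count s m (Suc r) < n"
proof -
  have "row_count s m (Suc r) \<le> (\<Sum>t=Suc 0..s. m t)"
    unfolding row_count_def by (rule sum_mono2) auto
  also have "\<dots> < n"
    using m0 by (simp add: n_eq sum.atLeast_Suc_atMost)
  finally show ?thesis .
qed

lemma row_psubset:
  assumes "\<eta> \<in> multiline_diagrams n s m" "r < s"
  shows "row \<eta> (Suc r) \<subset> {1..n}"
proof -
  have "row \<eta> (Suc r) \<subseteq> {1..n}" "card (row \<eta> (Suc r)) < card {1..n}"
    using assms row_count_less by (auto simp: multiline_diagrams_iff)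
  then show ?thesis by auto
qed

lemma multiline_diagrams_nonempty: "multiline_diagrams n s m \<noteq> {}"
proof -
  \<comment> \<open>The witness packs the particles of each row into its leftmost columns.\<close>
  have "row (SIGMA r:{1..s}. {1..row_count s m r}) (Suc r) = {1..row_count s m (Suc r)}"
    if "r < s" for r
    using that by (auto simp: row_def)
  then have "(SIGMA r:{1..s}. {1..row_count s m r}) \<in> multiline_diagrams n s m"
    using row_count_less by (fastforce simp: multiline_diagrams_iff intro: less_imp_le less_le_trans)
  then show ?thesis by auto
qed

lemma bell_out_in:
  assumes "\<eta> \<in> multiline_diagrams n s m" "i \<in> {1..n}" "r \<le> s"
  shows "bell_out n \<eta> i r \<in> {1..n}"
  using assms(3)
proof (induction r)
  case 0
  then show ?case using assms by simp
next
  case (Suc r)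
  then show ?case
    unfolding bell_out_Suc using assms(1) by (intro row_out_in row_psubset) auto
qed

lemma ring_bell_in:
  assumes "\<eta> \<in> multiline_diagrams n s m" "i \<in> {1..n}"
  shows "ring_bell n s i \<eta> \<in> multiline_diagrams n s m"
  unfolding multiline_diagrams_iff
proof (intro conjI allI impI)
  show "ring_bell n s i \<eta> \<subseteq> {1..s} \<times> UNIV"
    using assms(1) by (intro ring_bell_rows) (simp add: multiline_diagrams_iff)
  fix r assume r: "r < s"
  note R = row_psubset[OF assms(1) r]
  have eq: "row (ring_bell n s i \<eta>) (Suc r) = row_ring n (row \<eta> (Suc r)) (bell_out n \<eta> i r)"
    using r by (intro row_ring_bell) simp
  show "row (ring_bell n s i \<eta>) (Suc r) \<subseteq> {1..n}"
    unfolding eq using r assms by (intro row_ring_subset R bell_out_in) auto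
  show "card (row (ring_bell n s i \<eta>) (Suc r)) = row_count s m (Suc r)"
    unfolding eq card_row_ring[OF R] using assms(1) r by (simp add: multiline_diagrams_iff)
qed

text \<open>The move is undone from the top row downwards: the outgoing column of a row determines
  the old row and its incoming column, which is the outgoing column of the row below. At the bottom
  this yields the rung column.\<close>

lemma ring_bell_inj:
  assumes \<eta>: "\<eta> \<in> multiline_diagrams n s m" and \<eta>': "\<eta>' \<in> multiline_diagrams n s m"
    and ring: "ring_bell n s i \<eta> = ring_bell n s i' \<eta>'"
    and out: "bell_out n \<eta> i s = bell_out n \<eta>' i' s"
  shows "\<eta> = \<eta>' \<and> i = i'"
proof -
  have step: "row \<eta> (Suc r) = row \<eta>' (Suc r) \<and> bell_out n \<eta> i r = bell_out n \<eta>' i' r"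
    if "r < s" "bell_out n \<eta> i (Suc r) = bell_out n \<eta>' i' (Suc r)" for r
    using that row_ring_bell[of r s n i \<eta>] row_ring_bell[of r s n i' \<eta>'] ring
    by (intro row_ring_inj[of _ n] row_psubset \<eta> \<eta>')
      (auto simp: bell_out_Suc simp del: bell_out.simps(2))
  have outs: "bell_out n \<eta> i r = bell_out n \<eta>' i' r" if "r \<le> s" for r
    \<comment> \<open>The induction descends from \<open>s\<close>, where \<open>out\<close> gives
      the equality, to \<open>r\<close>.\<close>
    using that by (induction rule: inc_induct) (use out step in blast)+
  have "\<eta> = \<eta>'"
  proof (rule config_eqI)
    show "\<eta> \<subseteq> {1..s} \<times> UNIV" "\<eta>' \<subseteq> {1..s} \<times> UNIV"
      using \<eta> \<eta>' by (simp_all add: multiline_diagrams_iff)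
    show "row \<eta> (Suc r) = row \<eta>' (Suc r)" if "r < s" for r
      using step[OF that] outs[of "Suc r"] that by simp
  qed
  with outs[of 0] show ?thesis by simp
qed

lemma weight_ring_bell:
  fixes x :: "nat \<Rightarrow> real"
  assumes "\<eta> \<in> multiline_diagrams n s m" "i \<in> {1..n}"
  shows "weight n x (ring_bell n s i \<eta>) * x i = weight n x \<eta> * x (bell_out n \<eta> i s)"
proof -
  \<comment> \<open>Telescoping over the lowest \<open>k\<close> rows: each row trades the factor of
    its incoming column for that of its outgoing column.\<close>
  have "(\<Prod>r<k. prod x (row (ring_bell n s i \<eta>) (Suc r))) * x i
      = (\<Prod>r<k. prod x (row \<eta> (Suc r))) * x (bell_out n \<eta> i k)" if "k \<le> s" for k
    using that
  proof (induction k)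
    case 0
    then show ?case by simp
  next
    case (Suc k)
    then have k: "k < s" by simp
    from prod_row_ring[OF row_psubset[OF assms(1) k], of x "bell_out n \<eta> i k"]
    have row_step: "prod x (row (ring_bell n s i \<eta>) (Suc k)) * x (bell_out n \<eta> i k)
        = prod x (row \<eta> (Suc k)) * x (bell_out n \<eta> i (Suc k))"
      using k by (simp add: row_ring_bell bell_out_Suc del: bell_out.simps(2))
    have "(\<Prod>r<Suc k. prod x (row (ring_bell n s i \<eta>) (Suc r))) * x i
        = ((\<Prod>r<k. prod x (row (ring_bell n s i \<eta>) (Suc r))) * x i)
            * prod x (row (ring_bell n s i \<eta>) (Suc k))"
      by (simp add: mult_ac)
    also have "\<dots> = (\<Prod>r<k. prod x (row \<eta> (Suc r)))
        * (prod x (row (ring_bell n s i \<eta>) (Suc k)) * x (bell_out n \<eta> i k))"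
      using Suc by (simp add: mult_ac)
    also have "\<dots> = (\<Prod>r<Suc k. prod x (row \<eta> (Suc r))) * x (bell_out n \<eta> i (Suc k))"
      unfolding row_step by (simp add: mult_ac del: bell_out.simps(2))
    finally show ?case .
  qed
  from this[of s] show ?thesis
    using assms(1) ring_bell_in[OF assms]
    by (simp add: weight_eq_prod_rows[of _ s] multiline_diagrams_def)
qed

section \<open>Balance of the flows\<close>

lemma sum_weight_rate:
  fixes x :: "nat \<Rightarrow> real"
  assumes x: "\<And>i. i \<in> {1..n} \<Longrightarrow> x i > 0" and \<zeta>: "\<zeta> \<in> multiline_diagrams n s m"
  shows "(\<Sum>\<eta>\<in>multiline_diagrams n s m. weight n x \<eta> * multiline_rate n s x \<eta> \<zeta>)
       = weight n x \<zeta> * (\<Sum>j=1..n. 1 / x j)"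
proof -
  let ?\<Omega> = "multiline_diagrams n s m"
  let ?D = "?\<Omega> \<times> {1..n}"
  define \<Phi> where "\<Phi> = (\<lambda>(\<eta>, i). (ring_bell n s i \<eta>, bell_out n \<eta> i s))"
  \<comment> \<open>\<open>g\<close> expresses the flow into \<open>\<zeta>\<close> through the
    image under \<open>\<Phi>\<close>: the new diagram and the outgoing column.\<close>
  define g where "g = (\<lambda>(\<xi>, j). if \<xi> = \<zeta> then weight n x \<xi> / x j else 0)"
  have fin: "finite ?D" using finite_multiline_diagrams by simp
  have "inj_on \<Phi> ?D"
    using ring_bell_inj by (auto simp: inj_on_def \<Phi>_def)
  moreover have "\<Phi> ` ?D \<subseteq> ?D"
    using ring_bell_in bell_out_in[OF _ _ order_refl] by (auto simp: \<Phi>_def simp del: atLeastAtMost_iff)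
  \<comment> \<open>An injective map of a finite set into itself is onto, so no inverse has to be
    constructed.\<close>
  ultimately have bij: "bij_betw \<Phi> ?D ?D"
    using endo_inj_surj[OF fin] by (simp add: bij_betw_def)
  have "(\<Sum>\<eta>\<in>?\<Omega>. weight n x \<eta> * multiline_rate n s x \<eta> \<zeta>)
      = (\<Sum>\<eta>\<in>?\<Omega>. \<Sum>i=1..n. if ring_bell n s i \<eta> = \<zeta> then weight n x \<eta> / x i else 0)"
    unfolding multiline_rate_def sum_distrib_left
    by (rule sum.cong[OF refl]) (simp add: sum.inter_filter[symmetric])
  also have "\<dots> = (\<Sum>p\<in>?D. g (\<Phi> p))"
    unfolding sum.cartesian_product
  proof (intro sum.cong refl, clarify)
    fix \<eta> i assume p: "\<eta> \<in> ?\<Omega>" "i \<in> {1..n}"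
    have "x i > 0" "x (bell_out n \<eta> i s) > 0"
      using x p bell_out_in[OF p order_refl] by blast+
    then have "weight n x \<eta> / x i = weight n x (ring_bell n s i \<eta>) / x (bell_out n \<eta> i s)"
      using weight_ring_bell[OF p, of x] by (simp add: field_simps)
    then show "(if ring_bell n s i \<eta> = \<zeta> then weight n x \<eta> / x i else 0) = g (\<Phi> (\<eta>, i))"
      by (simp add: g_def \<Phi>_def)
  qed
  also have "\<dots> = (\<Sum>p\<in>?D. g p)"
    by (rule sum.reindex_bij_betw[OF bij])
  \<comment> \<open>By surjectivity every outgoing column \<open>j\<close> occurs with
    \<open>\<zeta>\<close> exactly once, which yields the full sum over \<open>j\<close>.\<close>
  also have "\<dots> = (\<Sum>\<xi>\<in>?\<Omega>. if \<xi> = \<zeta> then \<Sum>j=1..n. weight n x \<xi> / x j else 0)"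
    unfolding g_def sum.cartesian_product[symmetric] by (intro sum.cong refl) auto
  also have "\<dots> = weight n x \<zeta> * (\<Sum>j=1..n. 1 / x j)"
    using \<zeta> finite_multiline_diagrams by (simp add: sum.delta sum_distrib_left)
  finally show ?thesis .
qed

text \<open>Each of the \<open>n\<close> bells leads to exactly one diagram, so grouping the bells
  by their target recovers the total ringing rate, rings that change nothing included.\<close>

lemma sum_rate:
  assumes "\<zeta> \<in> multiline_diagrams n s m"
  shows "(\<Sum>\<xi>\<in>multiline_diagrams n s m. multiline_rate n s x \<zeta> \<xi>) = (\<Sum>j=1..n. 1 / x j)"
  unfolding multiline_rate_def
  by (rule sum.group) (use assms ring_bell_in finite_multiline_diagrams in auto)

end

theorem theorem12:
  fixes n s :: nat and m :: "nat \<Rightarrow> nat" and x :: "nat \<Rightarrow> real"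
  assumes "n = (\<Sum>r=0..s. m r)"
    and "m 0 \<ge> 1"
    and "\<And>i. i \<in> {1..n} \<Longrightarrow> x i > 0"
  shows "stationary_distribution (multiline_diagrams n s m) (multiline_rate n s x)
           (multiline_distribution n s m x)"
proof (rule stationary_distributionI)
  let ?\<Omega> = "multiline_diagrams n s m"
  show fin: "finite ?\<Omega>" by (rule finite_multiline_diagrams)
  have pos: "weight n x \<eta> > 0" for \<eta>
    unfolding weight_def using assms(3) by (intro prod_pos) auto
  have Z: "partition_function n s m x > 0"
    unfolding partition_function_def
    using multiline_diagrams_nonempty[OF assms(1,2)] fin pos by (intro sum_pos) auto
  show "prob_distribution ?\<Omega> (multiline_distribution n s m x)"
    unfolding prob_distribution_def multiline_distribution_def
    using Z pos by (auto simp: sum_divide_distrib[symmetric] partition_function_def[symmetric]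
        intro!: divide_nonneg_pos less_imp_le)
  \<comment> \<open>Both sides equal the probability of \<open>\<zeta>\<close> times the total
    ringing rate; the normalisation is a common factor.\<close>
  show "(\<Sum>\<eta>\<in>?\<Omega>. multiline_distribution n s m x \<eta> * multiline_rate n s x \<eta> \<zeta>)
      = multiline_distribution n s m x \<zeta> * (\<Sum>\<xi>\<in>?\<Omega>. multiline_rate n s x \<zeta> \<xi>)"
    if "\<zeta> \<in> ?\<Omega>" for \<zeta>
    using sum_weight_rate[OF assms that] sum_rate[OF assms(1,2) that]
    by (simp add: multiline_distribution_def sum_divide_distrib[symmetric])
qed

end
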